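(* Let $g:\mathbb{R}^n\to\mathbb{R}^s$ be $C^2$, $D\subset\mathbb{R}^s$ closed, $\Gamma=g^{-1}(D)$, $\bar x\in\Gamma$, and assume (A1), (A2). Let $\bar x^*\in\hat N_\Gamma(\bar x)$, let $\bar\lambda$ be the unique vector with $\bar\lambda\in\hat N_D(g(\bar x))$, $\nabla g(\bar x)^T\bar\lambda=\bar x^*$, and let $(u,u^* )\in T_{\operatorname{gph}\hat N_\Gamma}(\bar x,\bar x^* )$. Let $\bar\xi\in\mathbb{R}^s$ be the unique vector satisfying $$(\nabla g(\bar x)u,\bar\xi)\in T_{\operatorname{gph}\hat N_D}(g(\bar x),\bar\lambda),\qquad u^*=\nabla g(\bar x)^T\bar\xi+\nabla^2\langle\bar\lambda,g\rangle(\bar x)u.$$ Then for every $w\in\mathbb{R}^n$, $$D^*\hat N_\Gamma((\bar x,\bar x^* );(u,u^* ))(w)=\nabla^2\langle\bar\lambda,g\rangle(\bar x)w+\nabla g(\bar x)^T\,D^*\hat N_D((g(\bar x),\bar\lambda);(\nabla g(\bar x)u,\bar\xi))(\nabla g(\bar x)w).$$ In particular (taking $(u,u^* )=(0,0)$), $D^*\hat N_\Gamma(\bar x,\bar x^* )(w)=\nabla^2\langle\bar\lambda,g\rangle(\bar x)w+\nabla g(\bar x)^TD^*\hat N_D(g(\bar x),\bar\lambda)(\nabla g(\bar x)w)$.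
   Context: Standing assumptions (A1), (A2) for $g:\mathbb{R}^n\to\mathbb{R}^s$ ($C^2$), closed $D\subset\mathbb{R}^s$, $\Gamma=g^{-1}(D)$, $\bar x\in\Gamma$: (A1) There exist a closed set $\Theta\subset\mathbb{R}^d$, a twice continuously differentiable mapping $h:\mathbb{R}^s\to\mathbb{R}^d$ and a neighborhood $\mathcal V$ of $g(\bar x)$ such that $\nabla h(g(\bar x))$ is surjective and $D\cap\mathcal V=\{z\in\mathcal V\mid h(z)\in\Theta\}$. (A2) $\operatorname{range}\nabla g(\bar x)+\ker\nabla h(g(\bar x))=\mathbb{R}^s$. For closed $A$, $\bar a\in A$: $T_A(\bar a)=\limsup_{t\searrow0}(A-\bar a)/t$; $\hat N_A(\bar a)=(T_A(\bar a))^\circ$ ($\hat N_A(a)=\emptyset$ if $a\notin A$); the directional limiting normal cone in direction $d$ is $N_A(\bar a;d)=\limsup_{t\searrow0,\,d'\to d}\hat N_A(\bar a+td')$ (Painlevé–Kuratowski outer limit); the limiting normal cone is $N_A(\bar a)=N_A(\bar a;0)$. For a closed-graph multifunction $F:\mathbb{R}^n\rightrightarrows\mathbb{R}^z$ with $(\bar u,\bar v)\in\operatorname{gph}F$ and directions $(d,h)$, the directional limiting coderivative is $D^*F((\bar u,\bar v);(d,h))(v^* )=\{u^*\mid(u^*,-v^* )\in N_{\operatorname{gph}F}((\bar u,\bar v);(d,h))\}$, and the limiting coderivative is $D^*F(\bar u,\bar v)=D^*F((\bar u,\bar v);(0,0))$. $\nabla^2\langle\lambda,g\rangle(x)$ is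 the Hessian of $x\mapsto\langle\lambda,g(x)\rangle$. *)

theory Defs
  imports "HOL-Analysis.Analysis"
begin

text \<open>Contingent (Bouligand) tangent cone: the Painleve-Kuratowski outer limit
  of (A - a)/t as t decreases to 0, written out sequentially.\<close>
definition tangent_cone :: "'a::real_normed_vector set \<Rightarrow> 'a \<Rightarrow> 'a set" where
  "tangent_cone A a = {d. \<exists>t dd. (\<forall>k. 0 < t k) \<and> t \<longlonglongrightarrow> 0 \<and> dd \<longlonglongrightarrow> d \<and>
       (\<forall>k. a + t k *\<^sub>R dd k \<in> A)}"

definition polar_cone :: "'a::real_inner set \<Rightarrow> 'a set" where
  "polar_cone K = {v. \<forall>d\<in>K. inner v d \<le> 0}"

definition reg_normal :: "'a::real_inner set \<Rightarrow> 'a \<Rightarrow> 'a set" where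
  "reg_normal A a = (if a \<in> A then polar_cone (tangent_cone A a) else {})"

definition dir_lim_normal :: "'a::real_inner set \<Rightarrow> 'a \<Rightarrow> 'a \<Rightarrow> 'a set" where
  "dir_lim_normal A a d = {v. \<exists>t dd vv. (\<forall>k. 0 < t k) \<and> t \<longlonglongrightarrow> 0 \<and> dd \<longlonglongrightarrow> d \<and>
       vv \<longlonglongrightarrow> v \<and> (\<forall>k. vv k \<in> reg_normal A (a + t k *\<^sub>R dd k))}"

definition lim_normal :: "'a::real_inner set \<Rightarrow> 'a \<Rightarrow> 'a set" where
  "lim_normal A a = dir_lim_normal A a 0"

definition gph :: "('a \<Rightarrow> 'b set) \<Rightarrow> ('a \<times> 'b) set" where
  "gph F = {(u, v). v \<in> F u}"

definition dir_coderiv ::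
  "('a::real_inner \<Rightarrow> 'b::real_inner set) \<Rightarrow> 'a \<Rightarrow> 'b \<Rightarrow> 'a \<Rightarrow> 'b \<Rightarrow> 'b \<Rightarrow> 'a set" where
  "dir_coderiv F u v d h vs = {us. (us, - vs) \<in> dir_lim_normal (gph F) (u, v) (d, h)}"

definition lim_coderiv ::
  "('a::real_inner \<Rightarrow> 'b::real_inner set) \<Rightarrow> 'a \<Rightarrow> 'b \<Rightarrow> 'b \<Rightarrow> 'a set" where
  "lim_coderiv F u v vs = dir_coderiv F u v 0 0 vs"

text \<open>Hessian of x \<mapsto> <lam, g x> at x applied to w, given the second derivative
  g'' of g (g'' x w v = D^2 g(x)[w,v]): the vector z with z . v = lam . D^2 g(x)[w,v].\<close>
definition lag_hess ::
  "('n::real_inner \<Rightarrow> 'n \<Rightarrow>\<^sub>L ('n \<Rightarrow>\<^sub>L 's::real_inner)) \<Rightarrow> 's \<Rightarrow> 'n \<Rightarrow> 'n \<Rightarrow> 'n" where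
  "lag_hess g'' lam x w = adjoint (blinfun_apply (blinfun_apply (g'' x) w)) lam"

end

theory Submission
  imports Defs
begin

text \<open>With \<open>f = h \<circ> g\<close>, the point \<open>xb\<close> has a neighbourhood on which \<open>g -` D\<close> is the preimage of
  \<open>\<Theta>\<close> under \<open>f\<close>, and (A1), (A2) make \<open>f' xb\<close> surjective; likewise \<open>D\<close> is near \<open>g xb\<close> the preimage
  of \<open>\<Theta>\<close> under the submersion \<open>h\<close>. For a preimage under a submersion, tangent cones and regular
  normals of the graph of the normal cone map transform exactly at all nearby points, multipliers are
  unique and depend continuously on the data, and so the formula survives the passage to the
  directional limit. Comparing the two resulting formulas over the graph for \<open>\<Theta>\<close> eliminates \<open>\<Theta>\<close>.\<close>

subsection \<open>Sequential cones\<close>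

text \<open>The definition asks for membership at every index. Dropping an initial segment makes
  membership at large indices enough, which is all one gets when points enter an open set only
  eventually.\<close>

lemma tangent_coneI:
  assumes "t \<longlonglongrightarrow> 0" "dd \<longlonglongrightarrow> d"
    and "\<forall>\<^sub>F k in sequentially. 0 < t k \<and> a + t k *\<^sub>R dd k \<in> A"
  shows "d \<in> tangent_cone A a"
proof -
  obtain N where N: "\<And>k. k \<ge> N \<Longrightarrow> 0 < t k \<and> a + t k *\<^sub>R dd k \<in> A"
    using assms(3) unfolding eventually_sequentially by blast
  have "(\<lambda>k. t (k + N)) \<longlonglongrightarrow> 0" "(\<lambda>k. dd (k + N)) \<longlonglongrightarrow> d"
    using assms(1,2) by (auto intro: LIMSEQ_ignore_initial_segment)
  moreover have "\<forall>k. 0 < t (k + N)" "\<forall>k. a + t (k + N) *\<^sub>R dd (k + N) \<in> A"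
    using N by auto
  ultimately show ?thesis
    unfolding tangent_cone_def mem_Collect_eq
    by (intro exI[of _ "\<lambda>k. t (k + N)"] exI[of _ "\<lambda>k. dd (k + N)"] conjI)
qed

lemma dir_lim_normalI:
  assumes "t \<longlonglongrightarrow> 0" "dd \<longlonglongrightarrow> d" "vv \<longlonglongrightarrow> v"
    and "\<forall>\<^sub>F k in sequentially. 0 < t k \<and> vv k \<in> reg_normal A (a + t k *\<^sub>R dd k)"
  shows "v \<in> dir_lim_normal A a d"
proof -
  obtain N where N: "\<And>k. k \<ge> N \<Longrightarrow> 0 < t k \<and> vv k \<in> reg_normal A (a + t k *\<^sub>R dd k)"
    using assms(4) unfolding eventually_sequentially by blast
  have "(\<lambda>k. t (k + N)) \<longlonglongrightarrow> 0" "(\<lambda>k. dd (k + N)) \<longlonglongrightarrow> d" "(\<lambda>k. vv (k + N)) \<longlonglongrightarrow> v"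
    using assms(1-3) by (auto intro: LIMSEQ_ignore_initial_segment)
  moreover have "\<forall>k. 0 < t (k + N)"
    "\<forall>k. vv (k + N) \<in> reg_normal A (a + t (k + N) *\<^sub>R dd (k + N))"
    using N by auto
  ultimately show ?thesis
    unfolding dir_lim_normal_def mem_Collect_eq
    by (intro exI[of _ "\<lambda>k. t (k + N)"] exI[of _ "\<lambda>k. dd (k + N)"]
        exI[of _ "\<lambda>k. vv (k + N)"] conjI)
qed

lemma zero_in_tangent_cone:
  assumes "a \<in> A" shows "0 \<in> tangent_cone A a"
proof (rule tangent_coneI)
  show "(\<lambda>k. 1 / real (Suc k)) \<longlonglongrightarrow> 0" by (rule LIMSEQ_Suc) (rule lim_1_over_n)
  show "(\<lambda>k. 0) \<longlonglongrightarrow> (0::'a)" by simp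
qed (use assms in auto)

lemma reg_normal_imp_mem: "v \<in> reg_normal A a \<Longrightarrow> a \<in> A"
  by (auto simp: reg_normal_def split: if_splits)

text \<open>Frechet differentiability implies Hadamard differentiability: the direction may vary
  along a convergent sequence, because such a sequence is bounded and the remainder is small
  uniformly on bounded sets.\<close>

lemma has_derivative_difference_quotient_tendsto:
  assumes der: "(f has_derivative f') (at x)"
    and t: "\<And>k. 0 < t k" "t \<longlonglongrightarrow> 0" and uu: "uu \<longlonglongrightarrow> u"
  shows "(\<lambda>k. (f (x + t k *\<^sub>R uu k) - f x) /\<^sub>R t k) \<longlonglongrightarrow> f' u"
proof -
  have bl: "bounded_linear f'" using der by (rule has_derivative_bounded_linear)
  have lin: "linear f'" using bl by (rule bounded_linear.linear)
  define r where "r k = (f (x + t k *\<^sub>R uu k) - f x) /\<^sub>R t k - f' (uu k)" for k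
  obtain B where B: "B > 0" "\<And>k. norm (uu k) \<le> B"
    using Bseq_def convergent_imp_Bseq convergentI[OF uu] by metis
  have step: "(\<lambda>k. t k *\<^sub>R uu k) \<longlonglongrightarrow> 0"
    using tendsto_scaleR[OF t(2) uu] by simp
  have "r \<longlonglongrightarrow> 0"
  proof (rule tendstoI)
    fix e :: real assume "e > 0"
    \<comment> \<open>With \<open>B\<close> bounding all directions, the tolerance
      \<open>e / (2 * B)\<close> makes the remainder quotient at most \<open>e / 2\<close>, which is
      strictly below \<open>e\<close>.\<close>
    then have "e / (2 * B) > 0" using B by simp
    then obtain d where d: "d > 0"
      "\<And>y. norm (y - x) < d \<Longrightarrow> norm (f y - f x - f' (y - x)) \<le> e / (2 * B) * norm (y - x)"
      using der unfolding has_derivative_at_alt by blast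
    from step d(1) have "\<forall>\<^sub>F k in sequentially. norm (t k *\<^sub>R uu k) < d"
      by (auto dest!: tendstoD[where e = d] simp: dist_norm)
    then show "\<forall>\<^sub>F k in sequentially. dist (r k) 0 < e"
    proof eventually_elim
      case (elim k)
      have "r k = (f (x + t k *\<^sub>R uu k) - f x - f' (t k *\<^sub>R uu k)) /\<^sub>R t k"
        using t(1)[of k] by (simp add: r_def linear_scale[OF lin] scaleR_diff_right)
      then have "norm (r k) = norm (f (x + t k *\<^sub>R uu k) - f x - f' (t k *\<^sub>R uu k)) / t k"
        using t(1)[of k] by (simp only: norm_scaleR) (simp add: divide_inverse_commute)
      also have "\<dots> \<le> (e / (2 * B) * norm (t k *\<^sub>R uu k)) / t k"
        using d(2)[of "x + t k *\<^sub>R uu k"] elim t(1)[of k]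
        by (intro divide_right_mono) auto
      also have "\<dots> = e / (2 * B) * norm (uu k)"
        using t(1)[of k] by simp
      also have "\<dots> \<le> e / (2 * B) * B"
        using B \<open>e > 0\<close> by (intro mult_left_mono) auto
      also have "\<dots> < e" using B \<open>e > 0\<close> by simp
      finally show ?case by simp
    qed
  qed
  moreover have "(\<lambda>k. f' (uu k)) \<longlonglongrightarrow> f' u"
    using bounded_linear.tendsto[OF bl uu] .
  ultimately have "(\<lambda>k. r k + f' (uu k)) \<longlonglongrightarrow> 0 + f' u"
    by (rule tendsto_add)
  then show ?thesis by (simp add: r_def)
qed

subsection \<open>Surjective linear maps and adjoints\<close>

lemma adjoint_blinfun_inner:
  fixes A :: "'a::euclidean_space \<Rightarrow>\<^sub>L 'b::euclidean_space"
  shows "adjoint (blinfun_apply A) y \<bullet> x = y \<bullet> A x"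
    and "x \<bullet> adjoint (blinfun_apply A) y = A x \<bullet> y"
  by (simp_all add: adjoint_clauses linear_conv_bounded_linear blinfun.bounded_linear_right)

lemma adjoint_blinfun_eqI:
  fixes A :: "'a::euclidean_space \<Rightarrow>\<^sub>L 'b::euclidean_space"
  assumes "\<And>x. v \<bullet> x = y \<bullet> A x"
  shows "v = adjoint (blinfun_apply A) y"
  by (rule vector_eq_rdot[THEN iffD1]) (simp add: assms adjoint_blinfun_inner)

lemma linear_adjoint_blinfun:
  fixes A :: "'a::euclidean_space \<Rightarrow>\<^sub>L 'b::euclidean_space"
  shows "linear (adjoint (blinfun_apply A))"
  by (rule adjoint_linear) (simp add: linear_conv_bounded_linear blinfun.bounded_linear_right)

lemma adjoint_blinfun_diff_left:
  fixes A B :: "'a::euclidean_space \<Rightarrow>\<^sub>L 'b::euclidean_space"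
  shows "adjoint (blinfun_apply (A - B)) y = adjoint (blinfun_apply A) y - adjoint (blinfun_apply B) y"
  by (rule sym, rule adjoint_blinfun_eqI)
     (simp add: inner_diff_left inner_diff_right adjoint_blinfun_inner blinfun.diff_left)

lemma adjoint_blinfun_scaleR_left:
  fixes A :: "'a::euclidean_space \<Rightarrow>\<^sub>L 'b::euclidean_space"
  shows "adjoint (blinfun_apply (c *\<^sub>R A)) y = c *\<^sub>R adjoint (blinfun_apply A) y"
  by (rule sym, rule adjoint_blinfun_eqI) (simp add: adjoint_blinfun_inner blinfun.scaleR_left)

lemma adjoint_blinfun_add_left:
  fixes A B :: "'a::euclidean_space \<Rightarrow>\<^sub>L 'b::euclidean_space"
  shows "adjoint (blinfun_apply (A + B)) y = adjoint (blinfun_apply A) y + adjoint (blinfun_apply B) y"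
  by (rule sym, rule adjoint_blinfun_eqI)
     (simp add: inner_add_left inner_add_right adjoint_blinfun_inner blinfun.add_left)

lemma adjoint_blinfun_zero_left:
  "adjoint (blinfun_apply (0 :: 'a::euclidean_space \<Rightarrow>\<^sub>L 'b::euclidean_space)) y = 0"
  by (rule sym, rule adjoint_blinfun_eqI) simp

lemma adjoint_blinfun_compose:
  fixes A :: "'b::euclidean_space \<Rightarrow>\<^sub>L 'c::euclidean_space"
    and B :: "'a::euclidean_space \<Rightarrow>\<^sub>L 'b"
  shows "adjoint (blinfun_apply (A o\<^sub>L B)) y = adjoint (blinfun_apply B) (adjoint (blinfun_apply A) y)"
  by (rule sym, rule adjoint_blinfun_eqI) (simp add: adjoint_blinfun_inner)

text \<open>Joint continuity in the operator and the vector. The adjoint is given by a description,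
  so it is first expanded in coordinates, where each coefficient is visibly continuous.\<close>

lemma tendsto_adjoint_blinfun:
  fixes A :: "'c \<Rightarrow> 'a::euclidean_space \<Rightarrow>\<^sub>L 'b::euclidean_space"
  assumes "(A \<longlongrightarrow> A0) F" "(y \<longlongrightarrow> y0) F"
  shows "((\<lambda>k. adjoint (blinfun_apply (A k)) (y k)) \<longlongrightarrow> adjoint (blinfun_apply A0) y0) F"
proof -
  have "adjoint (blinfun_apply M) z = (\<Sum>b\<in>Basis. (M b \<bullet> z) *\<^sub>R b)"
    for M :: "'a \<Rightarrow>\<^sub>L 'b" and z
    by (subst euclidean_representation[symmetric]) (simp add: adjoint_blinfun_inner inner_commute)
  moreover have "((\<lambda>k. \<Sum>b\<in>Basis. (A k b \<bullet> y k) *\<^sub>R b) \<longlongrightarrow> (\<Sum>b\<in>Basis. (A0 b \<bullet> y0) *\<^sub>R b)) F"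
    by (intro tendsto_intros assms)
  ultimately show ?thesis by simp
qed

section \<open>Stability of surjectivity under small perturbations\<close>

lemma surj_blinfun_right_inverse:
  fixes A :: "'a::euclidean_space \<Rightarrow>\<^sub>L 'b::euclidean_space"
  assumes "surj (blinfun_apply A)"
  obtains R where "A o\<^sub>L R = id_blinfun" "\<And>y. A (R y) = y"
proof -
  have "linear (blinfun_apply A)"
    by (simp add: linear_conv_bounded_linear blinfun.bounded_linear_right)
  then obtain r where r: "linear r" "blinfun_apply A \<circ> r = id"
    using linear_surjective_right_inverse assms by blast
  then have "A (Blinfun r y) = y" for y
    by (metis bounded_linear_Blinfun_apply comp_apply id_apply linear_conv_bounded_linear)
  then show thesis
    by (intro that[of "Blinfun r"]) (auto intro!: blinfun_eqI)
qed

text \<open>The triangle inequality gives \<open>norm s \<le> 2 * norm (B s)\<close>, so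
  \<open>B\<close> is injective and, on a finite-dimensional space, surjective. The same inequality
  is the bound on the solution.\<close>

lemma near_id_blinfun_solvable:
  fixes B :: "'a::euclidean_space \<Rightarrow>\<^sub>L 'a"
  assumes "norm (B - id_blinfun) \<le> 1/2"
  obtains s where "B s = y" "norm s \<le> 2 * norm y"
proof -
  have lower: "norm s \<le> 2 * norm (B s)" for s
  proof -
    have "norm ((B - id_blinfun) s) \<le> 1/2 * norm s"
      using norm_blinfun[of "B - id_blinfun" s] assms
      by (meson mult_right_mono norm_ge_zero order_trans)
    moreover have "(B - id_blinfun) s = B s - s"
      by (simp add: blinfun.diff_left)
    ultimately show ?thesis
      using norm_triangle_ineq2[of s "B s"] by (simp add: norm_minus_commute)
  qed
  have lin: "linear (blinfun_apply B)"
    by (simp add: linear_conv_bounded_linear blinfun.bounded_linear_right)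
  have "inj (blinfun_apply B)"
    unfolding linear_injective_0[OF lin] using lower by (metis mult_zero_right norm_le_zero_iff norm_zero)
  then obtain s where "B s = y"
    using linear_injective_imp_surjective[OF lin] by (metis surjD)
  then show thesis using lower that by blast
qed

lemma eventually_near_right_inverse:
  fixes A0 :: "'a::euclidean_space \<Rightarrow>\<^sub>L 'b::euclidean_space"
  assumes "(A \<longlongrightarrow> A0) F" "A0 o\<^sub>L R = id_blinfun"
  shows "\<forall>\<^sub>F k in F. norm ((A k o\<^sub>L R) - id_blinfun) \<le> 1/2"
proof -
  have "((\<lambda>k. A k o\<^sub>L R) \<longlongrightarrow> id_blinfun) F"
    using bounded_bilinear.tendsto[OF bounded_bilinear_blinfun_compose assms(1) tendsto_const, of R]
    by (simp add: assms(2))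
  then show ?thesis
    by (auto dest!: tendstoD[where e = "1/2"] simp: dist_norm elim: eventually_mono)
qed

text \<open>Composed with a right inverse \<open>R\<close> of the limit, \<open>A k\<close> is close
  to the identity and hence onto; then \<open>A k\<close> itself is onto.\<close>

lemma eventually_surj_blinfun:
  fixes A0 :: "'a::euclidean_space \<Rightarrow>\<^sub>L 'b::euclidean_space"
  assumes "(A \<longlongrightarrow> A0) F" "surj (blinfun_apply A0)"
  shows "\<forall>\<^sub>F k in F. surj (blinfun_apply (A k))"
proof -
  obtain R where R: "A0 o\<^sub>L R = id_blinfun"
    using surj_blinfun_right_inverse assms(2) by metis
  show ?thesis
    using eventually_near_right_inverse[OF assms(1) R]
  proof eventually_elim
    case (elim k)
    have "\<exists>x. A k x = y" for y
    proof -
      obtain s where "(A k o\<^sub>L R) s = y" using near_id_blinfun_solvable[OF elim] by blast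
      then show ?thesis by auto
    qed
    then show ?case by (metis surjI)
  qed
qed

text \<open>Correct the constant guess \<open>w\<close> by \<open>R s\<close>, where
  \<open>s\<close> solves for the residual \<open>y k - A k w\<close>. The residual tends to 0, and
  the linear bound on \<open>s\<close> forces the correction to vanish.\<close>

lemma surj_blinfun_lift_sequence:
  fixes A0 :: "'a::euclidean_space \<Rightarrow>\<^sub>L 'b::euclidean_space"
  assumes A: "A \<longlonglongrightarrow> A0" and surj: "surj (blinfun_apply A0)" and y: "y \<longlonglongrightarrow> A0 w"
  obtains ww where "ww \<longlonglongrightarrow> w" "\<forall>\<^sub>F k in sequentially. A k (ww k) = y k"
proof -
  obtain R where R: "A0 o\<^sub>L R = id_blinfun"
    using surj_blinfun_right_inverse surj by metis
  note ev = eventually_near_right_inverse[OF A R]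
  define P where "P k s \<longleftrightarrow> (A k o\<^sub>L R) s = y k - A k w \<and> norm s \<le> 2 * norm (y k - A k w)" for k s
  define s where "s k = (SOME s. P k s)" for k
  have s: "\<forall>\<^sub>F k in sequentially. P k (s k)"
    using ev
  proof eventually_elim
    case (elim k)
    then have "\<exists>s. P k s"
      unfolding P_def using near_id_blinfun_solvable[OF elim] by metis
    then show ?case unfolding s_def by (rule someI_ex)
  qed
  have "(\<lambda>k. y k - A k w) \<longlonglongrightarrow> A0 w - A0 w"
    by (intro tendsto_intros A y)
  then have bound: "(\<lambda>k. 2 * norm (y k - A k w)) \<longlonglongrightarrow> 0"
    by (intro tendsto_mult_right_zero tendsto_norm_zero) simp
  have "s \<longlonglongrightarrow> 0"
    by (rule Lim_null_comparison[OF _ bound]) (use s in \<open>auto simp: P_def elim: eventually_mono\<close>)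
  then have "(\<lambda>k. w + R (s k)) \<longlonglongrightarrow> w"
    by (intro tendsto_eq_intros) auto
  moreover have "\<forall>\<^sub>F k in sequentially. A k (w + R (s k)) = y k"
    using s by eventually_elim (auto simp: P_def blinfun.add_right)
  ultimately show thesis by (rule that)
qed

text \<open>Adjoints of operators near a surjective one are uniformly injective, so convergence of
  the images forces convergence of the arguments. This yields convergence of whole multiplier
  sequences without passing to subsequences.\<close>

lemma adjoint_tendsto_imp_tendsto:
  fixes A0 :: "'a::euclidean_space \<Rightarrow>\<^sub>L 'b::euclidean_space"
  assumes A: "A \<longlonglongrightarrow> A0" and surj: "surj (blinfun_apply A0)"
    and lim: "(\<lambda>k. adjoint (blinfun_apply (A k)) (z k)) \<longlonglongrightarrow> c"
  obtains z0 where "z \<longlonglongrightarrow> z0" "c = adjoint (blinfun_apply A0) z0"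
proof -
  obtain R where R: "A0 o\<^sub>L R = id_blinfun"
    using surj_blinfun_right_inverse surj by metis
  define E where "E k = (A k o\<^sub>L R) - id_blinfun" for k
  define y where "y k = adjoint (blinfun_apply R) (adjoint (blinfun_apply (A k)) (z k))" for k
  define z0 where "z0 = adjoint (blinfun_apply R) c"
  have id: "adjoint (\<lambda>v::'b. v) = (\<lambda>v. v)"
    by (rule adjoint_unique) simp
  \<comment> \<open>\<open>y k\<close> is known to converge, and its distance to \<open>z k\<close>
    is controlled by the error operator \<open>E k\<close>, which tends to 0.\<close>
  have yz: "adjoint (blinfun_apply (E k)) (z k) = y k - z k" for k
    by (simp add: E_def y_def adjoint_blinfun_diff_left adjoint_blinfun_compose id)
  have y: "y \<longlonglongrightarrow> z0"
    unfolding y_def z0_def by (intro tendsto_adjoint_blinfun tendsto_const lim)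
  have ev: "\<forall>\<^sub>F k in sequentially. norm (E k) \<le> 1/2"
    using eventually_near_right_inverse[OF A R] by (simp add: E_def)
  have E: "E \<longlonglongrightarrow> 0"
    using bounded_bilinear.tendsto[OF bounded_bilinear_blinfun_compose A tendsto_const, of R]
    unfolding E_def R by (metis LIM_zero)
  have adj: "norm (adjoint (blinfun_apply (E k)) v) \<le> norm (E k) * norm v" for k v
  proof -
    let ?a = "adjoint (blinfun_apply (E k)) v"
    have "norm ?a * norm ?a = v \<bullet> E k ?a"
      by (metis adjoint_blinfun_inner(1) dot_square_norm power2_eq_square)
    also have "\<dots> \<le> norm v * (norm (E k) * norm ?a)"
      by (meson mult_left_mono norm_blinfun norm_cauchy_schwarz norm_ge_zero order_trans)
    finally have "norm ?a * norm ?a \<le> (norm (E k) * norm v) * norm ?a"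
      by (simp add: ac_simps)
    then show ?thesis
      by (cases "?a = 0") auto
  qed
  have bound: "(\<lambda>k. norm (E k) * (2 * norm (y k))) \<longlonglongrightarrow> 0"
    using E y by (auto intro!: tendsto_eq_intros)
  have "(\<lambda>k. y k - z k) \<longlonglongrightarrow> 0"
  proof (rule Lim_null_comparison[OF _ bound])
    show "\<forall>\<^sub>F k in sequentially. norm (y k - z k) \<le> norm (E k) * (2 * norm (y k))"
      using ev
    proof eventually_elim
      case (elim k)
      \<comment> \<open>Boundedness of \<open>z\<close> is not given; since
        \<open>norm (E k) \<le> 1/2\<close>, half of \<open>norm (z k)\<close> is absorbed, leaving
        \<open>norm (z k) \<le> 2 * norm (y k)\<close>.\<close>
      have "norm (y k - z k) \<le> norm (E k) * norm (z k)"
        using adj[of k "z k"] by (simp add: yz)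
      moreover have "norm (E k) * norm (z k) \<le> 1/2 * norm (z k)"
        using elim by (intro mult_right_mono) auto
      moreover have "norm (z k) \<le> norm (y k) + norm (y k - z k)"
        using norm_triangle_ineq4[of "y k" "y k - z k"] by simp
      ultimately have "norm (z k) \<le> 2 * norm (y k)" by linarith
      then have "norm (E k) * norm (z k) \<le> norm (E k) * (2 * norm (y k))"
        by (intro mult_left_mono) auto
      then show ?case using \<open>norm (y k - z k) \<le> norm (E k) * norm (z k)\<close> by linarith
    qed
  qed
  from tendsto_diff[OF y this] have z: "z \<longlonglongrightarrow> z0" by simp
  have "c = adjoint (blinfun_apply A0) z0"
    by (rule LIMSEQ_unique[OF lim]) (intro tendsto_adjoint_blinfun A z)
  with z show thesis by (rule that)
qed

section \<open>Range of the adjoint and polars of linear preimages\<close>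

lemma adjoint_surj_blinfun_cancel:
  fixes A :: "'a::euclidean_space \<Rightarrow>\<^sub>L 'b::euclidean_space"
  assumes "surj (blinfun_apply A)"
  shows "adjoint (blinfun_apply A) y = adjoint (blinfun_apply A) z \<longleftrightarrow> y = z"
  using assms surj_adjoint_iff_inj inj_adjoint_iff_surj
  by (metis blinfun.bounded_linear_right injD linear_conv_bounded_linear)

text \<open>Testing with \<open>u\<close> and \<open>-u\<close> shows that \<open>v\<close>
  annihilates the kernel, so it factors through \<open>A\<close>. As \<open>u - R (A u)\<close> lies
  in the kernel, the factor is the adjoint of the right inverse applied to \<open>v\<close>.\<close>

lemma orthogonal_kernel_imp_adjoint_range:
  fixes A :: "'a::euclidean_space \<Rightarrow>\<^sub>L 'b::euclidean_space"
  assumes "surj (blinfun_apply A)" "\<And>u. A u = 0 \<Longrightarrow> v \<bullet> u \<le> 0"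
  obtains y where "v = adjoint (blinfun_apply A) y"
proof -
  obtain R :: "'b \<Rightarrow>\<^sub>L 'a" where R: "\<And>y. A (R y) = y"
    using surj_blinfun_right_inverse assms(1) by metis
  have zero: "v \<bullet> u = 0" if "A u = 0" for u
    using assms(2)[of u] assms(2)[of "-u"] that by (auto simp: blinfun.minus_right)
  have "v \<bullet> u = adjoint (blinfun_apply R) v \<bullet> A u" for u
    using zero[of "u - R (A u)"]
    by (simp add: blinfun.diff_right R inner_diff_right adjoint_blinfun_inner)
  then show thesis
    by (intro that[of "adjoint (blinfun_apply R) v"] adjoint_blinfun_eqI)
qed

text \<open>Because \<open>0 \<in> K\<close>, the preimage contains the kernel of \<open>A\<close>,
  which places every polar vector in the range of the adjoint; surjectivity then lets the factor be
  tested on all of \<open>K\<close>.\<close>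

lemma polar_cone_vimage_surj:
  fixes A :: "'a::euclidean_space \<Rightarrow>\<^sub>L 'b::euclidean_space"
  assumes surj: "surj (blinfun_apply A)" and "0 \<in> K"
  shows "polar_cone {u. A u \<in> K} = adjoint (blinfun_apply A) ` polar_cone K"
proof safe
  fix v assume v: "v \<in> polar_cone {u. A u \<in> K}"
  obtain y where y: "v = adjoint (blinfun_apply A) y"
    using orthogonal_kernel_imp_adjoint_range[OF surj, of v] v \<open>0 \<in> K\<close>
    by (auto simp: polar_cone_def)
  have "y \<bullet> d \<le> 0" if "d \<in> K" for d
  proof -
    obtain u where "d = A u" using surj by (metis surjD)
    then show ?thesis using v that by (auto simp: polar_cone_def y adjoint_blinfun_inner)
  qed
  then show "v \<in> adjoint (blinfun_apply A) ` polar_cone K"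
    by (auto simp: y polar_cone_def)
qed (auto simp: polar_cone_def adjoint_blinfun_inner)

text \<open>The linear model for normals to the graph of a normal cone map. Self-adjointness moves
  \<open>H\<close> onto \<open>w\<close>, so the pairing becomes
  \<open>(v - H w) \<bullet> u - A w \<bullet> z\<close>. Choosing \<open>A u = 0\<close> and
  \<open>z = 0\<close> puts \<open>v - H w\<close> in the range of the adjoint.\<close>

lemma polar_cone_graph_pullback:
  fixes A :: "'a::euclidean_space \<Rightarrow>\<^sub>L 'b::euclidean_space"
  assumes surj: "surj (blinfun_apply A)" and "0 \<in> K"
    and sym: "\<And>u w. H w \<bullet> u = w \<bullet> H u"
  shows "(v, - w) \<in> polar_cone {(u, adjoint (blinfun_apply A) z + H u) | u z. (A u, z) \<in> K}
    \<longleftrightarrow> (\<exists>y. v = H w + adjoint (blinfun_apply A) y \<and> (y, - A w) \<in> polar_cone K)"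
    (is "_ \<in> polar_cone ?P \<longleftrightarrow> ?R")
proof
  assume "(v, - w) \<in> polar_cone ?P"
  then have le: "v \<bullet> u - w \<bullet> (adjoint (blinfun_apply A) z + H u) \<le> 0" if "(A u, z) \<in> K" for u z
    using that by (auto simp: polar_cone_def)
  have le': "(v - H w) \<bullet> u - A w \<bullet> z \<le> 0" if "(A u, z) \<in> K" for u z
    using le[OF that] by (simp add: inner_diff_left inner_add_right adjoint_blinfun_inner sym)
  have "(v - H w) \<bullet> u \<le> 0" if "A u = 0" for u
    using le'[of u 0] that \<open>0 \<in> K\<close> by (simp add: zero_prod_def)
  then obtain y where y: "v - H w = adjoint (blinfun_apply A) y"
    using orthogonal_kernel_imp_adjoint_range[OF surj] by blast
  have "y \<bullet> d - A w \<bullet> z \<le> 0" if "(d, z) \<in> K" for d z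
  proof -
    obtain u where "d = A u" using surj by (metis surjD)
    then show ?thesis using le'[of u z] that by (simp add: y adjoint_blinfun_inner)
  qed
  then have "(y, - A w) \<in> polar_cone K" by (auto simp: polar_cone_def)
  moreover have "v = H w + adjoint (blinfun_apply A) y" using y by (simp add: algebra_simps)
  ultimately show ?R by blast
next
  assume ?R
  then obtain y where y: "v = H w + adjoint (blinfun_apply A) y" "(y, - A w) \<in> polar_cone K"
    by blast
  have "y \<bullet> A u - A w \<bullet> z \<le> 0" if "(A u, z) \<in> K" for u z
    using y(2) that by (fastforce simp: polar_cone_def)
  then show "(v, - w) \<in> polar_cone ?P"
    by (auto simp: polar_cone_def y(1) inner_add_left inner_add_right adjoint_blinfun_inner sym)
qed

subsection \<open>Twice continuously differentiable maps\<close>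

text \<open>The mean value theorem is applied twice, once along \<open>v\<close> and once along
  \<open>w\<close>, turning the quotient into \<open>f''\<close> at an intermediate point that tends
  to \<open>x\<close>. The second difference itself does not see the order of \<open>v\<close> and
  \<open>w\<close>.\<close>

lemma second_difference_tendsto:
  fixes f :: "'a::real_normed_vector \<Rightarrow> real"
  assumes d1: "\<And>x. (f has_derivative f' x) (at x)"
    and d2: "\<And>x v. ((\<lambda>y. f' y v) has_derivative (\<lambda>w. f'' x w v)) (at x)"
    and cont: "\<And>w v. continuous_on UNIV (\<lambda>x. f'' x w v)"
    and s: "\<And>k. 0 < s k" "s \<longlonglongrightarrow> (0::real)"
  shows "(\<lambda>k. (f (x + s k *\<^sub>R v + s k *\<^sub>R w) - f (x + s k *\<^sub>R v) - f (x + s k *\<^sub>R w) + f x) / (s k)\<^sup>2)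
    \<longlonglongrightarrow> f'' x w v"
proof -
  have "\<exists>r q. 0 < r \<and> r < s k \<and> 0 < q \<and> q < s k \<and>
      (f (x + s k *\<^sub>R v + s k *\<^sub>R w) - f (x + s k *\<^sub>R v) - f (x + s k *\<^sub>R w) + f x) / (s k)\<^sup>2
        = f'' (x + r *\<^sub>R v + q *\<^sub>R w) w v" for k
  proof -
    have lin1: "f' y (c *\<^sub>R z) = c * f' y z" for y c z
      using linear_scale[OF has_derivative_linear[OF d1]] by (metis real_scaleR_def)
    have lin2: "f'' y (c *\<^sub>R z) v = c * f'' y z v" for y c z
      using linear_scale[OF has_derivative_linear[OF d2[of v y]]] by (metis real_scaleR_def)
    \<comment> \<open>First use: the increment of \<open>f\<close> in direction \<open>w\<close> is
      viewed as a function of the step along \<open>v\<close>.\<close>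
    have a: "((\<lambda>r. f (x + r *\<^sub>R v + s k *\<^sub>R w) - f (x + r *\<^sub>R v)) has_real_derivative
        f' (x + r *\<^sub>R v + s k *\<^sub>R w) v - f' (x + r *\<^sub>R v) v) (at r)" for r
      unfolding has_field_derivative_def
      by (rule derivative_eq_intros has_derivative_compose[OF _ d1] refl)+
         (auto simp: lin1 algebra_simps fun_eq_iff)
    from MVT2[OF s(1)[of k] a] obtain r where r: "0 < r" "r < s k"
      "f (x + s k *\<^sub>R v + s k *\<^sub>R w) - f (x + s k *\<^sub>R v) - (f (x + s k *\<^sub>R w) - f x)
       = s k * (f' (x + r *\<^sub>R v + s k *\<^sub>R w) v - f' (x + r *\<^sub>R v) v)"
      by auto
    \<comment> \<open>Second use: with \<open>r\<close> now fixed, the derivative in direction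
      \<open>v\<close> varies along \<open>w\<close>.\<close>
    have b: "((\<lambda>q. f' (x + r *\<^sub>R v + q *\<^sub>R w) v) has_real_derivative
        f'' (x + r *\<^sub>R v + q *\<^sub>R w) w v) (at q)" for q
    proof -
      have "((\<lambda>q. x + r *\<^sub>R v + q *\<^sub>R w) has_derivative (\<lambda>q. q *\<^sub>R w)) (at q)"
        by (auto intro!: derivative_eq_intros)
      from has_derivative_compose[OF this d2[where v = v]] show ?thesis
        by (simp add: has_field_derivative_def lin2 mult_commute_abs)
    qed
    from MVT2[OF s(1)[of k] b] obtain q where q: "0 < q" "q < s k"
      "f' (x + r *\<^sub>R v + s k *\<^sub>R w) v - f' (x + r *\<^sub>R v) v
       = s k * f'' (x + r *\<^sub>R v + q *\<^sub>R w) w v"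
      by auto
    have "f (x + s k *\<^sub>R v + s k *\<^sub>R w) - f (x + s k *\<^sub>R v) - f (x + s k *\<^sub>R w) + f x
        = (s k)\<^sup>2 * f'' (x + r *\<^sub>R v + q *\<^sub>R w) w v"
      using r(3) q(3) by (simp add: power2_eq_square)
    then show ?thesis using r(1,2) q(1,2) s(1)[of k] by (intro exI[of _ r] exI[of _ q]) simp
  qed
  then obtain r q where rq: "\<And>k. 0 < r k \<and> r k < s k \<and> 0 < q k \<and> q k < s k"
    and eq: "\<And>k. (f (x + s k *\<^sub>R v + s k *\<^sub>R w) - f (x + s k *\<^sub>R v) - f (x + s k *\<^sub>R w) + f x) / (s k)\<^sup>2
        = f'' (x + r k *\<^sub>R v + q k *\<^sub>R w) w v"
    by metis
  have "r \<longlonglongrightarrow> 0"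
    by (rule tendsto_sandwich[OF _ _ tendsto_const s(2)]) (simp_all add: rq less_imp_le)
  moreover have "q \<longlonglongrightarrow> 0"
    by (rule tendsto_sandwich[OF _ _ tendsto_const s(2)]) (simp_all add: rq less_imp_le)
  ultimately have "(\<lambda>k. x + r k *\<^sub>R v + q k *\<^sub>R w) \<longlonglongrightarrow> x"
    by (auto intro!: tendsto_eq_intros)
  from continuous_on_tendsto_compose[OF cont this, of w v]
  have "(\<lambda>k. f'' (x + r k *\<^sub>R v + q k *\<^sub>R w) w v) \<longlonglongrightarrow> f'' x w v" by simp
  then show ?thesis unfolding eq .
qed

text \<open>Schwarz's theorem: exchanging \<open>v\<close> and \<open>w\<close> leaves each second
  difference unchanged, so the two limits coincide.\<close>

lemma second_derivative_symmetric:
  fixes f :: "'a::real_normed_vector \<Rightarrow> real"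
  assumes "\<And>x. (f has_derivative f' x) (at x)"
    and "\<And>x v. ((\<lambda>y. f' y v) has_derivative (\<lambda>w. f'' x w v)) (at x)"
    and "\<And>w v. continuous_on UNIV (\<lambda>x. f'' x w v)"
  shows "f'' x w v = f'' x v w"
proof (rule LIMSEQ_unique)
  have s: "0 < 1 / real (Suc k)" "(\<lambda>k. 1 / real (Suc k)) \<longlonglongrightarrow> 0" for k
    using LIMSEQ_Suc[OF lim_1_over_n] by auto
  let ?q = "\<lambda>v w k. (f (x + (1 / real (Suc k)) *\<^sub>R v + (1 / real (Suc k)) *\<^sub>R w)
    - f (x + (1 / real (Suc k)) *\<^sub>R v) - f (x + (1 / real (Suc k)) *\<^sub>R w) + f x) / (1 / real (Suc k))\<^sup>2"
  show "?q v w \<longlonglongrightarrow> f'' x w v"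
    by (rule second_difference_tendsto[OF assms s])
  have "?q w v \<longlonglongrightarrow> f'' x v w"
    by (rule second_difference_tendsto[OF assms s])
  moreover have "?q w v = ?q v w"
    by (rule ext) (simp add: algebra_simps)
  ultimately show "?q v w \<longlonglongrightarrow> f'' x v w" by simp
qed

text \<open>\<open>f''\<close> takes its direction as a plain function argument, so the second
  derivative of a composition can be written pointwise. Continuity is therefore required jointly in
  the point and the direction.\<close>

locale c2_map =
  fixes f :: "'a::euclidean_space \<Rightarrow> 'b::euclidean_space"
    and f' :: "'a \<Rightarrow> 'a \<Rightarrow>\<^sub>L 'b"
    and f'' :: "'a \<Rightarrow> 'a \<Rightarrow> 'a \<Rightarrow>\<^sub>L 'b"
  assumes d1: "\<And>x. (f has_derivative blinfun_apply (f' x)) (at x)"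
    and d2: "\<And>x. (f' has_derivative f'' x) (at x)"
    and d2_cont: "continuous_on UNIV (\<lambda>(x, w). f'' x w)"
begin

definition hess :: "'b \<Rightarrow> 'a \<Rightarrow> 'a \<Rightarrow> 'a" where
  "hess lam x w = adjoint (blinfun_apply (f'' x w)) lam"

text \<open>Schwarz's theorem for the scalar function \<open>\<lambda>x. lam \<bullet> f x\<close>.
  This is the self-adjointness that \<open>polar_cone_graph_pullback\<close> asks of
  \<open>H\<close>.\<close>

lemma hess_symmetric: "hess lam x w \<bullet> u = w \<bullet> hess lam x u"
proof -
  have "lam \<bullet> f'' x w u = lam \<bullet> f'' x u w"
  proof (rule second_derivative_symmetric[where f = "\<lambda>x. lam \<bullet> f x"
        and f' = "\<lambda>x v. lam \<bullet> f' x v" and f'' = "\<lambda>x w v. lam \<bullet> f'' x w v"])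
    show "((\<lambda>x. lam \<bullet> f x) has_derivative (\<lambda>v. lam \<bullet> f' x v)) (at x)" for x
      by (intro has_derivative_inner_right d1)
    show "((\<lambda>y. lam \<bullet> f' y v) has_derivative (\<lambda>w. lam \<bullet> f'' x w v)) (at x)" for x v
      by (intro has_derivative_inner_right
          bounded_linear.has_derivative[OF blinfun.bounded_linear_left d2])
    show "continuous_on UNIV (\<lambda>x. lam \<bullet> f'' x w v)" for w v
      by (intro continuous_intros continuous_on_compose2[OF d2_cont, of UNIV "\<lambda>x. (x, w)", simplified])
  qed
  then show ?thesis by (simp add: hess_def adjoint_blinfun_inner inner_commute)
qed

lemma f'_tendsto: "xx \<longlonglongrightarrow> x \<Longrightarrow> (\<lambda>k. f' (xx k)) \<longlonglongrightarrow> f' x"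
  using has_derivative_continuous[OF d2] isCont_tendsto_compose by blast

lemma hess_tendsto:
  assumes "xx \<longlonglongrightarrow> x" "ww \<longlonglongrightarrow> w" "ll \<longlonglongrightarrow> lam"
  shows "(\<lambda>k. hess (ll k) (xx k) (ww k)) \<longlonglongrightarrow> hess lam x w"
  using continuous_on_tendsto_compose[OF d2_cont tendsto_Pair[OF assms(1,2)]]
  unfolding hess_def by (intro tendsto_adjoint_blinfun assms) simp

text \<open>With \<open>R\<close> a right inverse of \<open>A = f' x\<close>, the map \<open>F y = y + R (f y - A y)\<close> is a local
  diffeomorphism with \<open>F' x = id\<close> and \<open>A \<circ> F = f\<close>, so it straightens \<open>f\<close> to \<open>A\<close>.\<close>
lemma surj_derivative_lift_sequence:
  assumes surj: "surj (blinfun_apply (f' x))"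
    and t: "\<And>k. 0 < t k" "t \<longlonglongrightarrow> 0" and dd: "dd \<longlonglongrightarrow> f' x u"
  obtains uu where "uu \<longlonglongrightarrow> u"
    "\<forall>\<^sub>F k in sequentially. f (x + t k *\<^sub>R uu k) = f x + t k *\<^sub>R dd k"
proof -
  obtain R :: "'b \<Rightarrow>\<^sub>L 'a" where R: "\<And>y. f' x (R y) = y"
    using surj_blinfun_right_inverse[OF surj] by metis
  define F where "F y = y + R (f y - f' x y)" for y
  define F' where "F' y = id_blinfun + (R o\<^sub>L (f' y - f' x))" for y
  have AF: "f' x (F y) = f y" for y
    by (simp add: F_def blinfun.add_right R)
  have derF: "(F has_derivative blinfun_apply (F' y)) (at y)" for y
    unfolding F_def F'_def
    by (auto intro!: derivative_eq_intros d1 simp: blinfun.add_left blinfun.diff_left)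
  have F'x: "F' x = id_blinfun"
    by (auto intro!: blinfun_eqI simp: F'_def blinfun.add_left blinfun.diff_left)
  have "continuous_on UNIV f'"
    using has_derivative_continuous[OF d2] continuous_at_imp_continuous_on by blast
  then have contF: "continuous_on UNIV F'"
    unfolding F'_def
    by (intro continuous_intros bounded_bilinear.continuous_on[OF bounded_bilinear_blinfun_compose])
  obtain U' V G G' where G: "open V" "F x \<in> V" "x \<in> U'" "homeomorphism U' V F G"
    "\<And>y. y \<in> V \<Longrightarrow> (G has_derivative (G' y)) (at y)"
    "\<And>y. y \<in> V \<Longrightarrow> G' y = inv (blinfun_apply (F' (G y)))"
  proof (rule inverse_function_theorem[OF open_UNIV derF contF UNIV_I])
    show "id_blinfun o\<^sub>L F' x = id_blinfun"
      by (auto intro!: blinfun_eqI simp: F'x)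
  qed blast
  have GF: "G (F x) = x" using G(3,4) by (auto simp: homeomorphism_def)
  have FG: "F (G y) = y" if "y \<in> V" for y using that G(4) by (auto simp: homeomorphism_def)
  \<comment> \<open>The local inverse \<open>G\<close> has identity derivative at
    \<open>F x\<close>, so directions in the straightened coordinates and in the original ones have
    the same limit.\<close>
  have "G' (F x) = (\<lambda>v. v)"
    using G(6)[OF G(2)] by (simp add: GF F'x inv_id[unfolded id_def] fun_eq_iff)
  then have derG: "(G has_derivative (\<lambda>v. v)) (at (F x))"
    using G(5)[OF G(2)] by simp
  \<comment> \<open>\<open>pp k\<close> tends to \<open>u\<close> and satisfies
    \<open>f' x (pp k) = dd k\<close>; a step along it in straightened coordinates thus moves
    \<open>f\<close> by exactly \<open>t k *\<^sub>R dd k\<close>.\<close>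
  define pp where "pp k = u + R (dd k - f' x u)" for k
  define uu where "uu k = (G (F x + t k *\<^sub>R pp k) - x) /\<^sub>R t k" for k
  have "pp \<longlonglongrightarrow> u + R (f' x u - f' x u)"
    unfolding pp_def by (intro tendsto_intros dd)
  then have pp: "pp \<longlonglongrightarrow> u" by simp
  have "uu \<longlonglongrightarrow> u"
    unfolding uu_def using has_derivative_difference_quotient_tendsto[OF derG t pp] by (simp add: GF)
  moreover have "\<forall>\<^sub>F k in sequentially. f (x + t k *\<^sub>R uu k) = f x + t k *\<^sub>R dd k"
  proof -
    have "(\<lambda>k. F x + t k *\<^sub>R pp k) \<longlonglongrightarrow> F x"
      using t(2) pp by (auto intro!: tendsto_eq_intros)
    then have "\<forall>\<^sub>F k in sequentially. F x + t k *\<^sub>R pp k \<in> V"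
      using G(1,2) by (rule topological_tendstoD)
    then show ?thesis
    proof eventually_elim
      case (elim k)
      have "x + t k *\<^sub>R uu k = G (F x + t k *\<^sub>R pp k)"
        using t(1)[of k] by (simp add: uu_def)
      then have "f (x + t k *\<^sub>R uu k) = f' x (F x + t k *\<^sub>R pp k)"
        by (metis AF FG elim)
      also have "\<dots> = f x + t k *\<^sub>R dd k"
        by (simp add: blinfun.add_right blinfun.scaleR_right AF pp_def R)
      finally show ?case .
    qed
  qed
  ultimately show thesis by (rule that)
qed

section \<open>First-order expansion of the map sending a point and a multiplier to the adjoint
  derivative of the multiplier\<close>

lemma multiplier_quotient_tendsto:
  assumes t: "\<And>k. 0 < t k" "t \<longlonglongrightarrow> 0" and uu: "uu \<longlonglongrightarrow> u"
  shows "(\<lambda>k. adjoint (blinfun_apply ((f' (x + t k *\<^sub>R uu k) - f' x) /\<^sub>R t k)) mu) \<longlonglongrightarrow> hess mu x u"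
  unfolding hess_def
  by (intro tendsto_adjoint_blinfun tendsto_const has_derivative_difference_quotient_tendsto[OF d2 t uu])

lemma multiplier_expansion:
  assumes "t \<noteq> 0"
  shows "adjoint (blinfun_apply (f' (x + t *\<^sub>R v))) (mu + t *\<^sub>R z) =
    adjoint (blinfun_apply (f' x)) mu + t *\<^sub>R (adjoint (blinfun_apply (f' (x + t *\<^sub>R v))) z
      + adjoint (blinfun_apply ((f' (x + t *\<^sub>R v) - f' x) /\<^sub>R t)) mu)"
  using assms
  by (simp add: adjoint_blinfun_scaleR_left adjoint_blinfun_diff_left
      linear_add[OF linear_adjoint_blinfun] linear_scale[OF linear_adjoint_blinfun] algebra_simps)

end

subsection \<open>Preimages under submersions\<close>

locale submersion_preimage = c2_map +
  fixes \<Gamma> :: "'a set" and \<Theta> :: "'b set" and U :: "'a set"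
  assumes open_U: "open U"
    and surj: "\<And>x. x \<in> U \<Longrightarrow> surj (blinfun_apply (f' x))"
    and preimage: "\<And>x. x \<in> U \<Longrightarrow> x \<in> \<Gamma> \<longleftrightarrow> f x \<in> \<Theta>"
begin

lemma eventually_in_U:
  assumes "x \<in> U" "t \<longlonglongrightarrow> 0" "uu \<longlonglongrightarrow> u"
  shows "\<forall>\<^sub>F k in sequentially. x + t k *\<^sub>R uu k \<in> U"
proof -
  have "(\<lambda>k. x + t k *\<^sub>R uu k) \<longlonglongrightarrow> x"
    using assms(2,3) by (auto intro!: tendsto_eq_intros)
  then show ?thesis using open_U assms(1) by (rule topological_tendstoD)
qed

text \<open>Difference quotients of \<open>f\<close> carry tangent sequences forward;
  \<open>surj_derivative_lift_sequence\<close> lifts sequences in \<Theta> back to sequences that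
  map onto them exactly.\<close>

lemma tangent_cone_preimage:
  assumes x: "x \<in> U"
  shows "tangent_cone \<Gamma> x = {u. f' x u \<in> tangent_cone \<Theta> (f x)}"
proof safe
  fix u assume "u \<in> tangent_cone \<Gamma> x"
  then obtain t uu where t: "\<And>k. 0 < t k" "t \<longlonglongrightarrow> 0" and uu: "uu \<longlonglongrightarrow> u"
    and mem: "\<And>k. x + t k *\<^sub>R uu k \<in> \<Gamma>"
    unfolding tangent_cone_def by blast
  show "f' x u \<in> tangent_cone \<Theta> (f x)"
  proof (rule tangent_coneI)
    show "(\<lambda>k. (f (x + t k *\<^sub>R uu k) - f x) /\<^sub>R t k) \<longlonglongrightarrow> f' x u"
      by (rule has_derivative_difference_quotient_tendsto[OF d1 t uu])
    show "\<forall>\<^sub>F k in sequentially. 0 < t k \<and> f x + t k *\<^sub>R ((f (x + t k *\<^sub>R uu k) - f x) /\<^sub>R t k) \<in> \<Theta>"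
      using eventually_in_U[OF x t(2) uu]
    proof eventually_elim
      case (elim k)
      then show ?case using t(1)[of k] mem[of k] preimage by simp
    qed
  qed (rule t)
next
  fix u assume "f' x u \<in> tangent_cone \<Theta> (f x)"
  then obtain t dd where t: "\<And>k. 0 < t k" "t \<longlonglongrightarrow> 0" and dd: "dd \<longlonglongrightarrow> f' x u"
    and mem: "\<And>k. f x + t k *\<^sub>R dd k \<in> \<Theta>"
    unfolding tangent_cone_def by blast
  obtain uu where uu: "uu \<longlonglongrightarrow> u" and
    ev: "\<forall>\<^sub>F k in sequentially. f (x + t k *\<^sub>R uu k) = f x + t k *\<^sub>R dd k"
    using surj_derivative_lift_sequence[OF surj[OF x] t dd] by blast
  show "u \<in> tangent_cone \<Gamma> x"
  proof (rule tangent_coneI[OF t(2) uu])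
    show "\<forall>\<^sub>F k in sequentially. 0 < t k \<and> x + t k *\<^sub>R uu k \<in> \<Gamma>"
      using eventually_in_U[OF x t(2) uu] ev
      by eventually_elim (simp add: preimage t(1) mem)
  qed
qed

section \<open>Regular normals and their multipliers\<close>

lemma reg_normal_preimage:
  assumes x: "x \<in> U"
  shows "reg_normal \<Gamma> x = adjoint (blinfun_apply (f' x)) ` reg_normal \<Theta> (f x)"
  using polar_cone_vimage_surj[OF surj[OF x] zero_in_tangent_cone]
  by (simp add: reg_normal_def preimage[OF x] tangent_cone_preimage[OF x])

lemma gph_reg_normal_preimage:
  assumes x: "x \<in> U"
  shows "(x, adjoint (blinfun_apply (f' x)) mu) \<in> gph (reg_normal \<Gamma>) \<longleftrightarrow>
    (f x, mu) \<in> gph (reg_normal \<Theta>)"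
  by (auto simp: gph_def reg_normal_preimage[OF x] adjoint_surj_blinfun_cancel[OF surj[OF x]])

text \<open>Each nearby normal has a multiplier, written as \<open>mu + t k *\<^sub>R zz k\<close>.
  By \<open>multiplier_expansion\<close>, the adjoint derivative of \<open>zz k\<close> is
  \<open>vv k\<close> minus a quotient tending to the Hessian term, so
  \<open>adjoint_tendsto_imp_tendsto\<close> makes the rates \<open>zz\<close> converge.\<close>

lemma multiplier_sequence:
  assumes x: "x \<in> U" and t: "\<And>k. 0 < t k" "t \<longlonglongrightarrow> 0" and uu: "uu \<longlonglongrightarrow> u" and vv: "vv \<longlonglongrightarrow> v"
    and mem: "\<And>k. (x + t k *\<^sub>R uu k, adjoint (blinfun_apply (f' x)) mu + t k *\<^sub>R vv k) \<in> gph (reg_normal \<Gamma>)"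
  obtains zz z where "zz \<longlonglongrightarrow> z" "v = adjoint (blinfun_apply (f' x)) z + hess mu x u"
    "\<forall>\<^sub>F k in sequentially. adjoint (blinfun_apply (f' x)) mu + t k *\<^sub>R vv k =
      adjoint (blinfun_apply (f' (x + t k *\<^sub>R uu k))) (mu + t k *\<^sub>R zz k)"
proof -
  let ?A = "\<lambda>k. f' (x + t k *\<^sub>R uu k)"
  define P where "P k z \<longleftrightarrow> adjoint (blinfun_apply (f' x)) mu + t k *\<^sub>R vv k =
      adjoint (blinfun_apply (?A k)) (mu + t k *\<^sub>R z)" for k z
  define zz where "zz k = (SOME z. P k z)" for k
  have P: "\<forall>\<^sub>F k in sequentially. P k (zz k)"
    using eventually_in_U[OF x t(2) uu]
  proof eventually_elim
    case (elim k)
    obtain m where "adjoint (blinfun_apply (f' x)) mu + t k *\<^sub>R vv k = adjoint (blinfun_apply (?A k)) m"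
      using mem[of k] by (auto simp: gph_def reg_normal_preimage[OF elim])
    then have "P k ((m - mu) /\<^sub>R t k)"
      using t(1)[of k] by (simp add: P_def)
    then show ?case unfolding zz_def by (rule someI)
  qed
  let ?q = "\<lambda>k. adjoint (blinfun_apply ((?A k - f' x) /\<^sub>R t k)) mu"
  have "(\<lambda>k. x + t k *\<^sub>R uu k) \<longlonglongrightarrow> x"
    using t(2) uu by (auto intro!: tendsto_eq_intros)
  then have A: "?A \<longlonglongrightarrow> f' x" by (rule f'_tendsto)
  have q: "?q \<longlonglongrightarrow> hess mu x u" by (rule multiplier_quotient_tendsto[OF t uu])
  have "(\<lambda>k. adjoint (blinfun_apply (?A k)) (zz k)) \<longlonglongrightarrow> v - hess mu x u"
  proof (rule Lim_transform_eventually[OF tendsto_diff[OF vv q]])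
    show "\<forall>\<^sub>F k in sequentially. vv k - ?q k = adjoint (blinfun_apply (?A k)) (zz k)"
      using P
    proof eventually_elim
      case (elim k)
      have "t k \<noteq> 0" using t(1)[of k] by simp
      then have "vv k = adjoint (blinfun_apply (?A k)) (zz k) + ?q k"
        using elim unfolding P_def multiplier_expansion[OF \<open>t k \<noteq> 0\<close>] by simp
      then show ?case by simp
    qed
  qed
  from adjoint_tendsto_imp_tendsto[OF A surj[OF x] this]
  obtain z where "zz \<longlonglongrightarrow> z" "v - hess mu x u = adjoint (blinfun_apply (f' x)) z" by blast
  then show thesis using that P by (simp add: P_def algebra_simps)
qed

text \<open>The reverse construction: the primal directions are lifted through \<open>f\<close>, and
  the dual directions are then dictated by \<open>multiplier_expansion\<close>.\<close>

lemma primal_dual_sequence: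
  assumes x: "x \<in> U" and t: "\<And>k. 0 < t k" "t \<longlonglongrightarrow> 0"
    and dd: "dd \<longlonglongrightarrow> f' x u" and zz: "zz \<longlonglongrightarrow> z"
  obtains uu vv where "uu \<longlonglongrightarrow> u" "vv \<longlonglongrightarrow> adjoint (blinfun_apply (f' x)) z + hess mu x u"
    "\<forall>\<^sub>F k in sequentially. x + t k *\<^sub>R uu k \<in> U \<and> f (x + t k *\<^sub>R uu k) = f x + t k *\<^sub>R dd k \<and>
      adjoint (blinfun_apply (f' x)) mu + t k *\<^sub>R vv k =
        adjoint (blinfun_apply (f' (x + t k *\<^sub>R uu k))) (mu + t k *\<^sub>R zz k)"
proof -
  obtain uu where uu: "uu \<longlonglongrightarrow> u" and
    ev: "\<forall>\<^sub>F k in sequentially. f (x + t k *\<^sub>R uu k) = f x + t k *\<^sub>R dd k"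
    using surj_derivative_lift_sequence[OF surj[OF x] t dd] by blast
  let ?A = "\<lambda>k. f' (x + t k *\<^sub>R uu k)"
  define vv where "vv k = adjoint (blinfun_apply (?A k)) (zz k)
    + adjoint (blinfun_apply ((?A k - f' x) /\<^sub>R t k)) mu" for k
  have "(\<lambda>k. x + t k *\<^sub>R uu k) \<longlonglongrightarrow> x"
    using t(2) uu by (auto intro!: tendsto_eq_intros)
  then have A: "?A \<longlonglongrightarrow> f' x" by (rule f'_tendsto)
  have "vv \<longlonglongrightarrow> adjoint (blinfun_apply (f' x)) z + hess mu x u"
    unfolding vv_def
    by (intro tendsto_add tendsto_adjoint_blinfun A zz multiplier_quotient_tendsto[OF t uu])
  moreover have "adjoint (blinfun_apply (f' x)) mu + t k *\<^sub>R vv k =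
      adjoint (blinfun_apply (?A k)) (mu + t k *\<^sub>R zz k)" for k
    using multiplier_expansion[of "t k" x "uu k" mu "zz k"] t(1)[of k] by (simp add: vv_def)
  ultimately show thesis
    using that[OF uu] ev eventually_in_U[OF x t(2) uu] by (simp add: eventually_conj_iff)
qed

text \<open>Points of the two graphs near the reference pair correspond through a shared multiplier.
  Differentiating the adjoint derivative in the point produces the Hessian term, differentiating in
  the multiplier produces \<open>z\<close>.\<close>

lemma tangent_cone_gph_preimage:
  assumes x: "x \<in> U"
  shows "tangent_cone (gph (reg_normal \<Gamma>)) (x, adjoint (blinfun_apply (f' x)) mu) =
    {(u, adjoint (blinfun_apply (f' x)) z + hess mu x u) | u z.
      (f' x u, z) \<in> tangent_cone (gph (reg_normal \<Theta>)) (f x, mu)}"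
proof safe
  fix u v
  assume "(u, v) \<in> tangent_cone (gph (reg_normal \<Gamma>)) (x, adjoint (blinfun_apply (f' x)) mu)"
  then obtain t p where t: "\<And>k. 0 < t k" "t \<longlonglongrightarrow> 0" and p: "p \<longlonglongrightarrow> (u, v)"
    and mem: "\<And>k. (x, adjoint (blinfun_apply (f' x)) mu) + t k *\<^sub>R p k \<in> gph (reg_normal \<Gamma>)"
    unfolding tangent_cone_def by blast
  have uv: "(\<lambda>k. fst (p k)) \<longlonglongrightarrow> u" "(\<lambda>k. snd (p k)) \<longlonglongrightarrow> v"
    using tendsto_fst[OF p] tendsto_snd[OF p] by simp_all
  have mem': "(x + t k *\<^sub>R fst (p k), adjoint (blinfun_apply (f' x)) mu + t k *\<^sub>R snd (p k))
      \<in> gph (reg_normal \<Gamma>)" for k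
    using mem[of k] by (cases "p k") simp
  obtain zz z where zz: "zz \<longlonglongrightarrow> z" and v: "v = adjoint (blinfun_apply (f' x)) z + hess mu x u" and
    ev: "\<forall>\<^sub>F k in sequentially. adjoint (blinfun_apply (f' x)) mu + t k *\<^sub>R snd (p k) =
      adjoint (blinfun_apply (f' (x + t k *\<^sub>R fst (p k)))) (mu + t k *\<^sub>R zz k)"
    using multiplier_sequence[OF x t uv mem'] by blast
  have "(f' x u, z) \<in> tangent_cone (gph (reg_normal \<Theta>)) (f x, mu)"
  proof (rule tangent_coneI[OF t(2)])
    show "(\<lambda>k. ((f (x + t k *\<^sub>R fst (p k)) - f x) /\<^sub>R t k, zz k)) \<longlonglongrightarrow> (f' x u, z)"
      by (intro tendsto_Pair has_derivative_difference_quotient_tendsto[OF d1 t uv(1)] zz)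
    show "\<forall>\<^sub>F k in sequentially. 0 < t k \<and>
        (f x, mu) + t k *\<^sub>R ((f (x + t k *\<^sub>R fst (p k)) - f x) /\<^sub>R t k, zz k) \<in> gph (reg_normal \<Theta>)"
      using ev eventually_in_U[OF x t(2) uv(1)]
    proof eventually_elim
      case (elim k)
      show ?case
        using mem'[of k] t(1)[of k] unfolding elim(1) gph_reg_normal_preimage[OF elim(2)] by simp
    qed
  qed
  then show "\<exists>u' z. (u, v) = (u', adjoint (blinfun_apply (f' x)) z + hess mu x u') \<and>
      (f' x u', z) \<in> tangent_cone (gph (reg_normal \<Theta>)) (f x, mu)"
    using v by blast
next
  fix u z
  assume "(f' x u, z) \<in> tangent_cone (gph (reg_normal \<Theta>)) (f x, mu)"
  then obtain t p where t: "\<And>k. 0 < t k" "t \<longlonglongrightarrow> 0" and p: "p \<longlonglongrightarrow> (f' x u, z)"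
    and mem: "\<And>k. (f x, mu) + t k *\<^sub>R p k \<in> gph (reg_normal \<Theta>)"
    unfolding tangent_cone_def by blast
  have dz: "(\<lambda>k. fst (p k)) \<longlonglongrightarrow> f' x u" "(\<lambda>k. snd (p k)) \<longlonglongrightarrow> z"
    using tendsto_fst[OF p] tendsto_snd[OF p] by simp_all
  have mem': "(f x + t k *\<^sub>R fst (p k), mu + t k *\<^sub>R snd (p k)) \<in> gph (reg_normal \<Theta>)" for k
    using mem[of k] by (cases "p k") simp
  obtain uu vv where uv: "uu \<longlonglongrightarrow> u" "vv \<longlonglongrightarrow> adjoint (blinfun_apply (f' x)) z + hess mu x u" and
    ev: "\<forall>\<^sub>F k in sequentially. x + t k *\<^sub>R uu k \<in> U \<and> f (x + t k *\<^sub>R uu k) = f x + t k *\<^sub>R fst (p k) \<and>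
      adjoint (blinfun_apply (f' x)) mu + t k *\<^sub>R vv k =
        adjoint (blinfun_apply (f' (x + t k *\<^sub>R uu k))) (mu + t k *\<^sub>R snd (p k))"
    using primal_dual_sequence[OF x t dz] by blast
  show "(u, adjoint (blinfun_apply (f' x)) z + hess mu x u)
      \<in> tangent_cone (gph (reg_normal \<Gamma>)) (x, adjoint (blinfun_apply (f' x)) mu)"
  proof (rule tangent_coneI[OF t(2) tendsto_Pair[OF uv]])
    show "\<forall>\<^sub>F k in sequentially. 0 < t k \<and>
        (x, adjoint (blinfun_apply (f' x)) mu) + t k *\<^sub>R (uu k, vv k) \<in> gph (reg_normal \<Gamma>)"
      using ev
    proof eventually_elim
      case (elim k)
      then show ?case
        using mem'[of k] t(1)[of k] by (simp add: gph_reg_normal_preimage)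
    qed
  qed
qed

text \<open>On the graph this is \<open>polar_cone_graph_pullback\<close> for the tangent cone just
  computed, with the Hessian as \<open>H\<close>; off the graph both normal cones are empty.\<close>

lemma reg_normal_gph_preimage:
  assumes x: "x \<in> U"
  shows "(v, - w) \<in> reg_normal (gph (reg_normal \<Gamma>)) (x, adjoint (blinfun_apply (f' x)) mu) \<longleftrightarrow>
    (\<exists>y. v = hess mu x w + adjoint (blinfun_apply (f' x)) y \<and>
      (y, - f' x w) \<in> reg_normal (gph (reg_normal \<Theta>)) (f x, mu))"
proof (cases "(f x, mu) \<in> gph (reg_normal \<Theta>)")
  case True
  then show ?thesis
    using polar_cone_graph_pullback[OF surj[OF x] zero_in_tangent_cone[OF True],
        where H = "hess mu x", OF hess_symmetric]
    by (simp add: reg_normal_def gph_reg_normal_preimage[OF x] tangent_cone_gph_preimage[OF x])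
qed (simp add: reg_normal_def gph_reg_normal_preimage[OF x])

text \<open>\<open>reg_normal_gph_preimage\<close> is exact at every nearby pair. Stable
  surjectivity makes all auxiliary vectors converge, so the formula survives the limit in both
  directions.\<close>

theorem dir_lim_normal_gph_preimage:
  assumes x: "x \<in> U"
  shows "(v, - w) \<in> dir_lim_normal (gph (reg_normal \<Gamma>)) (x, adjoint (blinfun_apply (f' x)) mu)
      (u, adjoint (blinfun_apply (f' x)) z + hess mu x u) \<longleftrightarrow>
    (\<exists>y. v = hess mu x w + adjoint (blinfun_apply (f' x)) y \<and>
      (y, - f' x w) \<in> dir_lim_normal (gph (reg_normal \<Theta>)) (f x, mu) (f' x u, z))"
    (is "?L \<longleftrightarrow> ?R")
proof
  assume ?L
  then obtain t p n where t: "\<And>k. 0 < t k" "t \<longlonglongrightarrow> 0"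
    and p: "p \<longlonglongrightarrow> (u, adjoint (blinfun_apply (f' x)) z + hess mu x u)" and n: "n \<longlonglongrightarrow> (v, - w)"
    and nrm: "\<And>k. n k \<in> reg_normal (gph (reg_normal \<Gamma>)) ((x, adjoint (blinfun_apply (f' x)) mu) + t k *\<^sub>R p k)"
    unfolding dir_lim_normal_def by blast
  define uu where "uu k = fst (p k)" for k
  define vv where "vv k = snd (p k)" for k
  define nv where "nv k = fst (n k)" for k
  define ww where "ww k = - snd (n k)" for k
  have uu: "uu \<longlonglongrightarrow> u" and vv: "vv \<longlonglongrightarrow> adjoint (blinfun_apply (f' x)) z + hess mu x u"
    using tendsto_fst[OF p] tendsto_snd[OF p] by (simp_all add: uu_def[abs_def] vv_def[abs_def])
  have nv: "nv \<longlonglongrightarrow> v" and ww: "ww \<longlonglongrightarrow> w"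
    using tendsto_fst[OF n] tendsto_minus[OF tendsto_snd[OF n]]
    by (simp_all add: nv_def[abs_def] ww_def[abs_def])
  have nrm': "(nv k, - ww k) \<in> reg_normal (gph (reg_normal \<Gamma>))
      (x + t k *\<^sub>R uu k, adjoint (blinfun_apply (f' x)) mu + t k *\<^sub>R vv k)" for k
    using nrm[of k] by (cases "p k") (simp add: uu_def vv_def nv_def ww_def)
  obtain zz z' where zz: "zz \<longlonglongrightarrow> z'"
    and eq: "adjoint (blinfun_apply (f' x)) z + hess mu x u = adjoint (blinfun_apply (f' x)) z' + hess mu x u" and
    ev: "\<forall>\<^sub>F k in sequentially. adjoint (blinfun_apply (f' x)) mu + t k *\<^sub>R vv k =
      adjoint (blinfun_apply (f' (x + t k *\<^sub>R uu k))) (mu + t k *\<^sub>R zz k)"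
    using multiplier_sequence[OF x t uu vv reg_normal_imp_mem[OF nrm']] by blast
  \<comment> \<open>The prescribed direction fixes the limiting multiplier rate, as the adjoint is
    injective; the approach on the \<Theta> side therefore has direction
    \<open>(f' x u, z)\<close>.\<close>
  have "z' = z" using eq adjoint_surj_blinfun_cancel[OF surj[OF x]] by simp
  let ?x = "\<lambda>k. x + t k *\<^sub>R uu k"
  let ?m = "\<lambda>k. mu + t k *\<^sub>R zz k"
  \<comment> \<open>The pullback formula at the k-th pair: Hessian and adjoint are taken at the
    moving point, and the Hessian also at the moving multiplier.\<close>
  define P where "P k y \<longleftrightarrow> nv k = hess (?m k) (?x k) (ww k) + adjoint (blinfun_apply (f' (?x k))) y \<and>
      (y, - f' (?x k) (ww k)) \<in> reg_normal (gph (reg_normal \<Theta>)) (f (?x k), ?m k)" for k y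
  define yy where "yy k = (SOME y. P k y)" for k
  have P: "\<forall>\<^sub>F k in sequentially. P k (yy k)"
    using ev eventually_in_U[OF x t(2) uu]
  proof eventually_elim
    case (elim k)
    have "\<exists>y. P k y"
      using nrm'[of k] unfolding elim(1) reg_normal_gph_preimage[OF elim(2)] P_def .
    then show ?case unfolding yy_def by (rule someI_ex)
  qed
  have xlim: "?x \<longlonglongrightarrow> x" using t(2) uu by (auto intro!: tendsto_eq_intros)
  have mlim: "?m \<longlonglongrightarrow> mu" using t(2) zz by (auto intro!: tendsto_eq_intros)
  have "(\<lambda>k. adjoint (blinfun_apply (f' (?x k))) (yy k)) \<longlonglongrightarrow> v - hess mu x w"
    by (rule Lim_transform_eventually[OF tendsto_diff[OF nv hess_tendsto[OF xlim ww mlim]]])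
       (use P in \<open>auto simp: P_def elim: eventually_mono\<close>)
  from adjoint_tendsto_imp_tendsto[OF f'_tendsto[OF xlim] surj[OF x] this]
  obtain y where y: "yy \<longlonglongrightarrow> y" "v - hess mu x w = adjoint (blinfun_apply (f' x)) y" by blast
  have "(y, - f' x w) \<in> dir_lim_normal (gph (reg_normal \<Theta>)) (f x, mu) (f' x u, z)"
  proof (rule dir_lim_normalI[OF t(2)])
    show "(\<lambda>k. ((f (?x k) - f x) /\<^sub>R t k, zz k)) \<longlonglongrightarrow> (f' x u, z)"
      using zz \<open>z' = z\<close>
      by (intro tendsto_Pair has_derivative_difference_quotient_tendsto[OF d1 t uu]) simp
    show "(\<lambda>k. (yy k, - f' (?x k) (ww k))) \<longlonglongrightarrow> (y, - f' x w)"
      by (intro tendsto_intros y(1) f'_tendsto xlim ww)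
    show "\<forall>\<^sub>F k in sequentially. 0 < t k \<and> (yy k, - f' (?x k) (ww k)) \<in> reg_normal (gph (reg_normal \<Theta>))
        ((f x, mu) + t k *\<^sub>R ((f (?x k) - f x) /\<^sub>R t k, zz k))"
      using P
    proof eventually_elim
      case (elim k)
      then show ?case using t(1)[of k] by (simp add: P_def)
    qed
  qed
  moreover have "v = hess mu x w + adjoint (blinfun_apply (f' x)) y"
    using y(2) by (simp add: algebra_simps)
  ultimately show ?R by blast
next
  assume ?R
  then obtain y where v: "v = hess mu x w + adjoint (blinfun_apply (f' x)) y"
    and "(y, - f' x w) \<in> dir_lim_normal (gph (reg_normal \<Theta>)) (f x, mu) (f' x u, z)"
    by blast
  then obtain t p n where t: "\<And>k. 0 < t k" "t \<longlonglongrightarrow> 0"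
    and p: "p \<longlonglongrightarrow> (f' x u, z)" and n: "n \<longlonglongrightarrow> (y, - f' x w)"
    and nrm: "\<And>k. n k \<in> reg_normal (gph (reg_normal \<Theta>)) ((f x, mu) + t k *\<^sub>R p k)"
    unfolding dir_lim_normal_def by blast
  define dd where "dd k = fst (p k)" for k
  define zz where "zz k = snd (p k)" for k
  define yy where "yy k = fst (n k)" for k
  define bb where "bb k = - snd (n k)" for k
  have dd: "dd \<longlonglongrightarrow> f' x u" and zz: "zz \<longlonglongrightarrow> z"
    using tendsto_fst[OF p] tendsto_snd[OF p] by (simp_all add: dd_def[abs_def] zz_def[abs_def])
  have yy: "yy \<longlonglongrightarrow> y" and bb: "bb \<longlonglongrightarrow> f' x w"
    using tendsto_fst[OF n] tendsto_minus[OF tendsto_snd[OF n]]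
    by (simp_all add: yy_def[abs_def] bb_def[abs_def])
  have nrm': "(yy k, - bb k) \<in> reg_normal (gph (reg_normal \<Theta>))
      (f x + t k *\<^sub>R dd k, mu + t k *\<^sub>R zz k)" for k
    using nrm[of k] by (cases "p k") (simp add: dd_def zz_def yy_def bb_def)
  obtain uu vv where uu: "uu \<longlonglongrightarrow> u" and vv: "vv \<longlonglongrightarrow> adjoint (blinfun_apply (f' x)) z + hess mu x u" and
    ev: "\<forall>\<^sub>F k in sequentially. x + t k *\<^sub>R uu k \<in> U \<and> f (x + t k *\<^sub>R uu k) = f x + t k *\<^sub>R dd k \<and>
      adjoint (blinfun_apply (f' x)) mu + t k *\<^sub>R vv k =
        adjoint (blinfun_apply (f' (x + t k *\<^sub>R uu k))) (mu + t k *\<^sub>R zz k)"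
    using primal_dual_sequence[OF x t dd zz] by blast
  let ?x = "\<lambda>k. x + t k *\<^sub>R uu k"
  let ?m = "\<lambda>k. mu + t k *\<^sub>R zz k"
  have xlim: "?x \<longlonglongrightarrow> x" using t(2) uu by (auto intro!: tendsto_eq_intros)
  have mlim: "?m \<longlonglongrightarrow> mu" using t(2) zz by (auto intro!: tendsto_eq_intros)
  \<comment> \<open>The given normals have second component \<open>- bb k\<close>, while the
    pullback formula needs the form \<open>- f' (?x k) (ww k)\<close>; solving for
    \<open>ww k\<close> keeps the limit \<open>w\<close>.\<close>
  obtain ww where ww: "ww \<longlonglongrightarrow> w" "\<forall>\<^sub>F k in sequentially. f' (?x k) (ww k) = bb k"
    using surj_blinfun_lift_sequence[OF f'_tendsto[OF xlim] surj[OF x] bb] by blast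
  define nv where "nv k = hess (?m k) (?x k) (ww k) + adjoint (blinfun_apply (f' (?x k))) (yy k)" for k
  have "nv \<longlonglongrightarrow> v"
    unfolding nv_def v
    by (intro tendsto_add hess_tendsto tendsto_adjoint_blinfun xlim mlim ww(1) yy f'_tendsto)
  show ?L
  proof (rule dir_lim_normalI[OF t(2) tendsto_Pair[OF uu vv]
        tendsto_Pair[OF \<open>nv \<longlonglongrightarrow> v\<close> tendsto_minus[OF ww(1)]]])
    show "\<forall>\<^sub>F k in sequentially. 0 < t k \<and> (nv k, - ww k) \<in> reg_normal (gph (reg_normal \<Gamma>))
        ((x, adjoint (blinfun_apply (f' x)) mu) + t k *\<^sub>R (uu k, vv k))"
      using ev ww(2)
    proof eventually_elim
      case (elim k)
      then have "(nv k, - ww k) \<in> reg_normal (gph (reg_normal \<Gamma>))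
          (?x k, adjoint (blinfun_apply (f' (?x k))) (?m k))"
        using nrm'[of k] by (auto simp: reg_normal_gph_preimage nv_def)
      then show ?case using elim t(1)[of k] by simp
    qed
  qed
qed

end

section \<open>Comparison of the two pullback formulas and elimination of \<Theta>\<close>

theorem mainTheorem7:
  fixes g :: "real^'n \<Rightarrow> real^'s"
    and g' :: "real^'n \<Rightarrow> ((real^'n) \<Rightarrow>\<^sub>L (real^'s))"
    and g'' :: "real^'n \<Rightarrow> ((real^'n) \<Rightarrow>\<^sub>L ((real^'n) \<Rightarrow>\<^sub>L (real^'s)))"
    and h :: "real^'s \<Rightarrow> real^'d"
    and h' :: "real^'s \<Rightarrow> ((real^'s) \<Rightarrow>\<^sub>L (real^'d))"
    and h'' :: "real^'s \<Rightarrow> ((real^'s) \<Rightarrow>\<^sub>L ((real^'s) \<Rightarrow>\<^sub>L (real^'d)))"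
    and D :: "(real^'s) set" and \<Theta> :: "(real^'d) set" and V :: "(real^'s) set"
    and xb xs u us w :: "real^'n" and lam xi :: "real^'s"
  assumes g_d1: "\<And>x. (g has_derivative blinfun_apply (g' x)) (at x)"
    and g_d2: "\<And>x. (g' has_derivative blinfun_apply (g'' x)) (at x)"
    and g_c2: "continuous_on UNIV g''"
    and h_d1: "\<And>z. (h has_derivative blinfun_apply (h' z)) (at z)"
    and h_d2: "\<And>z. (h' has_derivative blinfun_apply (h'' z)) (at z)"
    and h_c2: "continuous_on UNIV h''"
    and D_closed: "closed D"
    and xb_in: "xb \<in> g -` D"
    and A1_Theta: "closed \<Theta>"
    and A1_nbhd: "g xb \<in> interior V"
    and A1_loc: "D \<inter> V = {z \<in> V. h z \<in> \<Theta>}"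
    and A1_surj: "surj (blinfun_apply (h' (g xb)))"
    and A2: "{a + b | a b. a \<in> range (blinfun_apply (g' xb)) \<and>
                blinfun_apply (h' (g xb)) b = 0} = UNIV"
    and xs_normal: "xs \<in> reg_normal (g -` D) xb"
    and lam_normal: "lam \<in> reg_normal D (g xb)"
    and lam_mult: "adjoint (blinfun_apply (g' xb)) lam = xs"
    and tangent: "(u, us) \<in> tangent_cone (gph (reg_normal (g -` D))) (xb, xs)"
    and xi_tan: "(blinfun_apply (g' xb) u, xi) \<in> tangent_cone (gph (reg_normal D)) (g xb, lam)"
    and xi_eq: "us = adjoint (blinfun_apply (g' xb)) xi + lag_hess g'' lam xb u"
  shows "dir_coderiv (reg_normal (g -` D)) xb xs u us w =
           (\<lambda>eta. lag_hess g'' lam xb w + adjoint (blinfun_apply (g' xb)) eta) `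
             dir_coderiv (reg_normal D) (g xb) lam (blinfun_apply (g' xb) u) xi
               (blinfun_apply (g' xb) w)
         \<and> lim_coderiv (reg_normal (g -` D)) xb xs w =
           (\<lambda>eta. lag_hess g'' lam xb w + adjoint (blinfun_apply (g' xb)) eta) `
             lim_coderiv (reg_normal D) (g xb) lam (blinfun_apply (g' xb) w)"
proof -
  define f where "f = (\<lambda>x. h (g x))"
  define f' where "f' x = h' (g x) o\<^sub>L g' x" for x
  \<comment> \<open>The product rule applied to \<open>h' (g x) o\<^sub>L g' x\<close>, with the
    chain rule in the outer factor.\<close>
  define f'' where "f'' x v = (h' (g x) o\<^sub>L g'' x v) + (h'' (g x) (g' x v) o\<^sub>L g' x)" for x v
  note compose_cont [continuous_intros] =
    bounded_bilinear.continuous_on[OF bounded_bilinear_blinfun_compose]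
  have cont: "continuous_on UNIV g" "continuous_on UNIV g'" "continuous_on UNIV h'"
    using has_derivative_continuous[OF g_d1] has_derivative_continuous[OF g_d2]
      has_derivative_continuous[OF h_d2] by (auto intro: continuous_at_imp_continuous_on)
  note cont_comp [continuous_intros] = continuous_on_compose2[OF cont(1) _ subset_UNIV]
    continuous_on_compose2[OF cont(2) _ subset_UNIV] continuous_on_compose2[OF cont(3) _ subset_UNIV]
    continuous_on_compose2[OF g_c2 _ subset_UNIV] continuous_on_compose2[OF h_c2 _ subset_UNIV]
  interpret H: c2_map h h' "\<lambda>z. blinfun_apply (h'' z)"
    by unfold_locales (auto intro!: h_d1 h_d2 continuous_intros simp: case_prod_beta)
  interpret F: c2_map f f' f''
  proof
    show "(f has_derivative blinfun_apply (f' x)) (at x)" for x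
      using has_derivative_compose[OF g_d1 h_d1] by (simp add: f_def f'_def comp_def blinfun_compose.rep_eq)
    show "(f' has_derivative f'' x) (at x)" for x
      using bounded_bilinear.FDERIV[OF bounded_bilinear_blinfun_compose
          has_derivative_compose[OF g_d1 h_d2] g_d2]
      by (simp add: f'_def[abs_def] f''_def[abs_def])
    show "continuous_on UNIV (\<lambda>(x, w). f'' x w)"
      unfolding f''_def case_prod_beta by (intro continuous_intros)
  qed
  have surj_f: "surj (blinfun_apply (f' xb))"
  proof -
    have "\<exists>x. f' xb x = y" for y
    proof -
      obtain z where z: "y = h' (g xb) z" using A1_surj by (metis surjD)
      \<comment> \<open>(A2) splits off a part killed by \<open>h' (g xb)\<close>, so
        \<open>a\<close> alone already reaches \<open>y\<close> under the composed
        derivative.\<close>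
      obtain a b where "z = g' xb a + b" "h' (g xb) b = 0" using A2 by blast
      then show ?thesis by (intro exI[of _ a]) (simp add: f'_def z blinfun.add_right)
    qed
    then show ?thesis by (metis surjI)
  qed
  have "\<forall>\<^sub>F x in nhds xb. g x \<in> interior V \<and> surj (blinfun_apply (f' x))"
  proof (rule eventually_conj)
    have "isCont g xb" by (rule has_derivative_continuous[OF g_d1])
    then have "(g \<longlongrightarrow> g xb) (nhds xb)"
      by (simp add: continuous_at tendsto_nhds_iff)
    then show "\<forall>\<^sub>F x in nhds xb. g x \<in> interior V"
      using open_interior A1_nbhd by (rule topological_tendstoD)
    have "isCont f' xb" by (rule has_derivative_continuous[OF F.d2])
    then have "(f' \<longlongrightarrow> f' xb) (nhds xb)"
      by (simp add: continuous_at tendsto_nhds_iff)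
    then show "\<forall>\<^sub>F x in nhds xb. surj (blinfun_apply (f' x))"
      using surj_f by (rule eventually_surj_blinfun)
  qed
  then obtain U where U: "open U" "xb \<in> U"
    "\<And>x. x \<in> U \<Longrightarrow> g x \<in> interior V \<and> surj (blinfun_apply (f' x))"
    unfolding eventually_nhds by blast
  have "\<forall>\<^sub>F z in nhds (g xb). z \<in> interior V \<and> surj (blinfun_apply (h' z))"
  proof (rule eventually_conj)
    show "\<forall>\<^sub>F z in nhds (g xb). z \<in> interior V"
      using open_interior A1_nbhd by (rule eventually_nhds_in_open)
    have "isCont h' (g xb)" by (rule has_derivative_continuous[OF h_d2])
    then have "(h' \<longlongrightarrow> h' (g xb)) (nhds (g xb))"
      by (simp add: continuous_at tendsto_nhds_iff)
    then show "\<forall>\<^sub>F z in nhds (g xb). surj (blinfun_apply (h' z))"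
      using A1_surj by (rule eventually_surj_blinfun)
  qed
  then obtain W where W: "open W" "g xb \<in> W"
    "\<And>z. z \<in> W \<Longrightarrow> z \<in> interior V \<and> surj (blinfun_apply (h' z))"
    unfolding eventually_nhds by blast
  have D_iff: "z \<in> D \<longleftrightarrow> h z \<in> \<Theta>" if "z \<in> interior V" for z
    using A1_loc interior_subset that by blast
  interpret H: submersion_preimage h h' "\<lambda>z. blinfun_apply (h'' z)" D \<Theta> W
    by unfold_locales (use W D_iff in auto)
  interpret F: submersion_preimage f f' f'' "g -` D" \<Theta> U
    by unfold_locales (use U D_iff in \<open>auto simp: f_def\<close>)
  let ?G = "adjoint (blinfun_apply (g' xb))" and ?Hh = "adjoint (blinfun_apply (h' (g xb)))"
  \<comment> \<open>\<open>mu\<close> is the multiplier of \<open>lam\<close> with respect to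
    \<Theta>; by the chain rule it is also the multiplier of \<open>xs\<close> for the composition,
    so both formulas refer to the same point of the \<Theta> graph.\<close>
  obtain mu where mu: "lam = ?Hh mu"
    using lam_normal by (auto simp: H.reg_normal_preimage[OF W(2)])
  have xs: "adjoint (blinfun_apply (f' xb)) mu = xs"
    by (simp add: f'_def adjoint_blinfun_compose mu[symmetric] lam_mult)
  \<comment> \<open>Chain rule for Hessians. The second summand is the Hessian term that the formula
    for \<open>D\<close> contributes under \<open>?G\<close>.\<close>
  have hess: "F.hess mu xb v = lag_hess g'' lam xb v + ?G (H.hess mu (g xb) (g' xb v))" for v
    by (simp add: F.hess_def H.hess_def lag_hess_def f''_def adjoint_blinfun_add_left
        adjoint_blinfun_compose mu)
  note lin = linear_add[OF linear_adjoint_blinfun] linear_0[OF linear_adjoint_blinfun]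
  \<comment> \<open>Stated for a general direction with multiplier rate \<open>z\<close>, so that it
    serves both the given direction and the zero direction. Both coderivatives are expressed by the
    one cone \<open>?N\<close>.\<close>
  have main: "dir_coderiv (reg_normal (g -` D)) xb xs a (?G b + lag_hess g'' lam xb a) w =
      (\<lambda>eta. lag_hess g'' lam xb w + ?G eta) `
        dir_coderiv (reg_normal D) (g xb) lam (g' xb a) b (g' xb w)"
    if b: "b = ?Hh z + H.hess mu (g xb) (g' xb a)" for a b z
  proof -
    have dir: "?G b + lag_hess g'' lam xb a = adjoint (blinfun_apply (f' xb)) z + F.hess mu xb a"
      by (simp add: b hess lin f'_def adjoint_blinfun_compose)
    let ?N = "dir_lim_normal (gph (reg_normal \<Theta>)) (h (g xb), mu) (h' (g xb) (g' xb a), z)"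
    have L: "v \<in> dir_coderiv (reg_normal (g -` D)) xb xs a (?G b + lag_hess g'' lam xb a) w \<longleftrightarrow>
        (\<exists>y. v = F.hess mu xb w + adjoint (blinfun_apply (f' xb)) y \<and>
          (y, - h' (g xb) (g' xb w)) \<in> ?N)" for v
      using F.dir_lim_normal_gph_preimage[OF U(2), of v w mu a z]
      unfolding dir_coderiv_def dir xs mem_Collect_eq by (simp add: f_def f'_def)
    have R: "eta \<in> dir_coderiv (reg_normal D) (g xb) lam (g' xb a) b (g' xb w) \<longleftrightarrow>
        (\<exists>y. eta = H.hess mu (g xb) (g' xb w) + ?Hh y \<and>
          (y, - h' (g xb) (g' xb w)) \<in> ?N)" for eta
      using H.dir_lim_normal_gph_preimage[OF W(2), of eta "g' xb w" mu "g' xb a" z]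
      unfolding dir_coderiv_def b mu mem_Collect_eq by simp
    have eq: "F.hess mu xb w + adjoint (blinfun_apply (f' xb)) y =
        lag_hess g'' lam xb w + ?G (H.hess mu (g xb) (g' xb w) + ?Hh y)" for y
      by (simp add: hess lin f'_def adjoint_blinfun_compose)
    show ?thesis
      by (intro set_eqI) (simp add: L R eq image_iff Bex_def, blast)
  qed
  \<comment> \<open>The tangent cone formula for the graph over \<open>D\<close> supplies the rate
    \<open>z\<close> behind \<open>xi\<close>.\<close>
  obtain z where "xi = ?Hh z + H.hess mu (g xb) (g' xb u)"
    using xi_tan unfolding mu H.tangent_cone_gph_preimage[OF W(2)] by blast
  from main[OF this]
  have "dir_coderiv (reg_normal (g -` D)) xb xs u us w =
      (\<lambda>eta. lag_hess g'' lam xb w + ?G eta) `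
        dir_coderiv (reg_normal D) (g xb) lam (g' xb u) xi (g' xb w)"
    by (simp add: xi_eq)
  \<comment> \<open>The zero direction has rate \<open>z = 0\<close>, which turns
    \<open>main\<close> into the formula for the limiting coderivatives.\<close>
  moreover have "0 = ?Hh 0 + H.hess mu (g xb) (g' xb 0)"
    by (simp add: H.hess_def lin adjoint_blinfun_zero_left)
  from main[OF this]
  have "lim_coderiv (reg_normal (g -` D)) xb xs w =
      (\<lambda>eta. lag_hess g'' lam xb w + ?G eta) `
        lim_coderiv (reg_normal D) (g xb) lam (g' xb w)"
    by (simp add: lim_coderiv_def lag_hess_def lin adjoint_blinfun_zero_left)
  ultimately show ?thesis by blast
qed

end
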